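(* Let $G$ be a twin-free graph of order $n$ with no isolated vertices. Then $\overset{\rightarrow}{\gamma}_{LD}(G)\leq n/2$.
   Context: All graphs are finite and simple. For an undirected graph $G=(V,E)$ and $S\subseteq V$, $S$ is a locating-dominating set of $G$ if every $u\in V\setminus S$ has $N(u)\cap S\neq\emptyset$ and for all distinct $u,v\in V\setminus S$, $N(u)\cap S\neq N(v)\cap S$. An orientation $D$ of $G$ is obtained by giving each edge exactly one direction. A set $S$ is a locating-dominating set of $D$ if every $u\in V\setminus S$ has $N^-_D(u)\cap S\neq\emptyset$ and for all distinct $u,v\in V\setminus S$, $N^-_D(u)\cap S\neq N^-_D(v)\cap S$ (where $N^-_D(u)$ is the set of in-neighbours of $u$); $\gamma_{LD}(D)$ is the minimum size of such a set. The lower directed location-domination number is $\overset{\rightarrow}{\gamma}_{LD}(G)=\min\{\gamma_{LD}(D): D \text{ an orientation of } G\}$. Two distinct vertices $u,v$ are twins if $N(u)=N(v)$ or $N[u]=N[v]$ (open or closed neighbourhoods); $G$ is twin-free if it has no pair of twins. *)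

theory Defs
  imports Complex_Main "Graph_Theory.Pair_Digraph"
begin

text \<open>
  An undirected finite simple graph is a \<^locale>\<open>pair_graph\<close>: a symmetric, loop-free,
  finite digraph, in which an edge \<open>uv\<close> is the pair of arcs \<open>(u, v)\<close> and \<open>(v, u)\<close>.
\<close>

definition nbhd :: "'a pair_pre_digraph \<Rightarrow> 'a \<Rightarrow> 'a set" where
  "nbhd G u = {v. (u, v) \<in> parcs G}"

definition closed_nbhd :: "'a pair_pre_digraph \<Rightarrow> 'a \<Rightarrow> 'a set" where
  "closed_nbhd G u = insert u (nbhd G u)"

definition isolated :: "'a pair_pre_digraph \<Rightarrow> 'a \<Rightarrow> bool" where
  "isolated G u \<longleftrightarrow> u \<in> pverts G \<and> nbhd G u = {}"

definition twins :: "'a pair_pre_digraph \<Rightarrow> 'a \<Rightarrow> 'a \<Rightarrow> bool" where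
  "twins G u v \<longleftrightarrow> u \<in> pverts G \<and> v \<in> pverts G \<and> u \<noteq> v \<and>
     (nbhd G u = nbhd G v \<or> closed_nbhd G u = closed_nbhd G v)"

definition twin_free :: "'a pair_pre_digraph \<Rightarrow> bool" where
  "twin_free G \<longleftrightarrow> (\<nexists>u v. twins G u v)"

definition orientation :: "'a pair_pre_digraph \<Rightarrow> 'a pair_pre_digraph \<Rightarrow> bool" where
  "orientation G D \<longleftrightarrow> pverts D = pverts G \<and> parcs D \<subseteq> parcs G \<and>
     (\<forall>(u, v) \<in> parcs G. (u, v) \<in> parcs D \<longleftrightarrow> (v, u) \<notin> parcs D)"

definition in_nbhd :: "'a pair_pre_digraph \<Rightarrow> 'a \<Rightarrow> 'a set" where
  "in_nbhd D u = {v. (v, u) \<in> parcs D}"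

definition locating_dominating :: "'a pair_pre_digraph \<Rightarrow> 'a set \<Rightarrow> bool" where
  "locating_dominating D S \<longleftrightarrow> S \<subseteq> pverts D \<and>
     (\<forall>u \<in> pverts D - S. in_nbhd D u \<inter> S \<noteq> {}) \<and>
     (\<forall>u \<in> pverts D - S. \<forall>v \<in> pverts D - S. u \<noteq> v \<longrightarrow>
        in_nbhd D u \<inter> S \<noteq> in_nbhd D v \<inter> S)"

definition gamma_LD :: "'a pair_pre_digraph \<Rightarrow> nat" where
  "gamma_LD D = Min {card S | S. locating_dominating D S}"

definition lower_gamma_LD :: "'a pair_pre_digraph \<Rightarrow> nat" where
  "lower_gamma_LD G = Min {gamma_LD D | D. orientation G D}"

text \<open>
  Both minima range over finite nonempty sets, so that \<^const>\<open>Min\<close> is meaningful.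
\<close>

lemma locating_dominating_cards:
  assumes "finite (pverts D)"
  shows "finite {card S | S. locating_dominating D S}"
    and "{card S | S. locating_dominating D S} \<noteq> {}"
proof -
  have "{card S | S. locating_dominating D S} \<subseteq> card ` Pow (pverts D)"
    by (auto simp: locating_dominating_def)
  then show "finite {card S | S. locating_dominating D S}"
    by (rule finite_subset) (simp add: assms)
  have "locating_dominating D (pverts D)"
    by (simp add: locating_dominating_def)
  then show "{card S | S. locating_dominating D S} \<noteq> {}"
    by blast
qed

lemma orientation_gammas:
  assumes "pair_graph G"
  shows "finite {gamma_LD D | D. orientation G D}"
    and "{gamma_LD D | D. orientation G D} \<noteq> {}"
proof -
  interpret pair_graph G by fact
  have "D \<in> (\<lambda>A. \<lparr>pverts = pverts G, parcs = A\<rparr>) ` Pow (parcs G)" if "orientation G D" for D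
    using that by (intro image_eqI[where x = "parcs D"]) (auto simp: orientation_def)
  then have "{gamma_LD D | D. orientation G D}
      \<subseteq> gamma_LD ` (\<lambda>A. \<lparr>pverts = pverts G, parcs = A\<rparr>) ` Pow (parcs G)"
    by blast
  then show "finite {gamma_LD D | D. orientation G D}"
    by (rule finite_subset) (simp add: pair_finite_arcs)
  obtain f :: "'a \<Rightarrow> nat" where f: "inj_on f (pverts G)"
    using finite_imp_inj_to_nat_seg[OF pair_finite_verts] by blast
  let ?D = "\<lparr>pverts = pverts G, parcs = {(u, v) \<in> parcs G. f u < f v}\<rparr>"
  have arc: "(u, v) \<in> parcs ?D \<longleftrightarrow> (v, u) \<notin> parcs ?D" if "(u, v) \<in> parcs G" for u v
  proof -
    have "u \<noteq> v"
      using pair_no_loops[OF that] by simp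
    then have "f u \<noteq> f v"
      using f in_arcsD1[OF that] in_arcsD2[OF that] by (metis inj_on_contraD)
    moreover have "(v, u) \<in> parcs G"
      using pair_sym_arcs that unfolding symmetric_def with_proj_simps by (rule symD)
    ultimately show ?thesis
      using that by auto
  qed
  have "orientation G ?D"
    unfolding orientation_def
  proof (intro conjI)
    show "\<forall>(u, v) \<in> parcs G. (u, v) \<in> parcs ?D \<longleftrightarrow> (v, u) \<notin> parcs ?D"
      using arc by blast
  qed auto
  then show "{gamma_LD D | D. orientation G D} \<noteq> {}"
    by blast
qed

end

theory Submission
  imports Defs
begin

text \<open>
  Only the arcs between \<open>S\<close> and its complement matter, so one has to find \<open>S\<close> with at most half of
  the vertices together with an injective choice of nonempty sets \<open>f v \<subseteq> N(v) \<inter> S\<close> for \<open>v \<notin> S\<close>.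
  Take a maximum matching \<open>p\<close> with set \<open>U\<close> of exposed vertices and let \<open>S\<close> contain one end of
  every matching edge. Put \<open>f u = N(u) \<inter> S\<close> on \<open>U\<close> and \<open>f v = {p v}\<close> elsewhere. The only possible
  conflicts come from \<open>u \<in> U\<close> whose neighbourhood lies in one matching edge \<open>{a, b}\<close>; then \<open>b\<close>
  could equally well be exposed, and one puts \<open>f b = N(b) \<inter> S\<close> too. If \<open>S\<close> is chosen to contain the
  end of each matching edge that sees these critical vertices, any remaining coincidence
  gives an augmenting path or a pair of twins.
\<close>

section \<open>From an injective choice of sets to an orientation\<close>

lemma lower_gamma_LD_le:
  assumes "pair_graph G" and S: "S \<subseteq> pverts G"
    and f: "\<And>v. v \<in> pverts G - S \<Longrightarrow> f v \<noteq> {} \<and> f v \<subseteq> nbhd G v \<inter> S"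
    and inj: "inj_on f (pverts G - S)"
  shows "lower_gamma_LD G \<le> card S"
proof -
  interpret pair_graph G by fact
  have sym: "(v, u) \<in> parcs G" if "(u, v) \<in> parcs G" for u v
    using pair_sym_arcs that unfolding symmetric_def with_proj_simps by (rule symD)
  obtain g :: "'a \<Rightarrow> nat" where g: "inj_on g (pverts G)"
    using finite_imp_inj_to_nat_seg[OF pair_finite_verts] by blast
  \<comment> \<open>Between \<open>S\<close> and its complement, v receives arcs exactly from
    \<open>f v\<close> and sends out the rest, so \<open>f v\<close> becomes its in-trace on
    \<open>S\<close>. Edges within either side only need some direction, which \<open>g\<close>
    supplies.\<close>
  define A where "A = {(u, v) \<in> parcs G.
    if u \<in> S \<and> v \<notin> S then u \<in> f v else if u \<notin> S \<and> v \<in> S then v \<notin> f u else g u < g v}"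
  define D where "D = \<lparr>pverts = pverts G, parcs = A\<rparr>"
  have neq: "g u \<noteq> g v" if "(u, v) \<in> parcs G" for u v
    using pair_no_loops[OF that] g in_arcsD1[OF that] in_arcsD2[OF that]
    by (metis inj_on_contraD fst_conv snd_conv)
  have D: "orientation G D"
    unfolding orientation_def D_def A_def using sym neq by (fastforce split: if_splits)
  have nb: "in_nbhd D v \<inter> S = f v" if "v \<in> pverts G - S" for v
    using f[OF that] that sym by (auto simp: in_nbhd_def D_def A_def nbhd_def)
  have "locating_dominating D S"
    unfolding locating_dominating_def
    using S f inj nb by (auto simp: D_def dest: inj_onD)
  then have "gamma_LD D \<le> card S"
    unfolding gamma_LD_def
    using locating_dominating_cards(1)[of D] by (intro Min_le) (auto simp: D_def)
  moreover have "lower_gamma_LD G \<le> gamma_LD D"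
    unfolding lower_gamma_LD_def
    using orientation_gammas(1)[OF \<open>pair_graph G\<close>] D by (intro Min_le) auto
  ultimately show ?thesis
    by simp
qed

section \<open>Maximum matchings and alternating paths\<close>

context pair_graph
begin

abbreviation adj :: "'a \<Rightarrow> 'a \<Rightarrow> bool" where
  "adj u v \<equiv> (u, v) \<in> parcs G"

lemma adj_sym: "adj u v \<Longrightarrow> adj v u"
  using pair_sym_arcs unfolding symmetric_def with_proj_simps by (rule symD)

lemma adj_neq: "adj u v \<Longrightarrow> u \<noteq> v"
  using pair_no_loops by fastforce

lemma adj_verts: "adj u v \<Longrightarrow> u \<in> pverts G \<and> v \<in> pverts G"
  using in_arcsD1 in_arcsD2 by blast

text \<open>A matching is encoded as the involution that swaps the ends of every matching edge.\<close>

definition matching :: "('a \<Rightarrow> 'a) \<Rightarrow> bool" where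
  "matching p \<longleftrightarrow> (\<forall>x\<in>pverts G. p (p x) = x \<and> (p x = x \<or> adj x (p x)))"

definition exposed :: "('a \<Rightarrow> 'a) \<Rightarrow> 'a set" where
  "exposed p = {x \<in> pverts G. p x = x}"

definition maximum_matching :: "('a \<Rightarrow> 'a) \<Rightarrow> bool" where
  "maximum_matching p \<longleftrightarrow> matching p \<and> (\<forall>q. matching q \<longrightarrow> card (exposed p) \<le> card (exposed q))"

lemma maximum_matching_exists: "\<exists>p. maximum_matching p"
proof -
  have "matching id"
    by (simp add: matching_def)
  from ex_has_least_nat[of matching, OF this, of "\<lambda>p. card (exposed p)"]
  show ?thesis
    unfolding maximum_matching_def by blast
qed

lemma finite_exposed: "finite (exposed p)"
  by (simp add: exposed_def)

text \<open>Otherwise adding the edge to the matching would leave fewer exposed vertices.\<close>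

lemma exposed_not_adj:
  assumes p: "maximum_matching p" and w: "w \<in> exposed p" "w' \<in> exposed p"
  shows "\<not> adj w w'"
proof
  assume a: "adj w w'"
  define q where "q = p(w := w', w' := w)"
  have m: "matching p"
    using p by (simp add: maximum_matching_def)
  have "p x \<noteq> w" "p x \<noteq> w'" if "x \<in> pverts G" "x \<noteq> w" "x \<noteq> w'" for x
    using m w that unfolding matching_def exposed_def by auto
  then have "matching q"
    using m w a adj_sym[OF a] adj_neq[OF a] unfolding matching_def q_def exposed_def by auto
  moreover have "exposed q \<subset> exposed p"
    using w adj_neq[OF a] by (auto simp: exposed_def q_def)
  ultimately show False
    using p psubset_card_mono[OF finite_exposed, of "exposed q" p]
    unfolding maximum_matching_def by fastforce
qed

text \<open>Swapping along the alternating path u, a, \<open>p a\<close> moves exposure from u to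
  \<open>p a\<close> and keeps the number of exposed vertices. Augmenting paths are excluded below
  by such swaps followed by \<open>exposed_not_adj\<close>.\<close>

lemma exchange:
  assumes p: "maximum_matching p" and u: "u \<in> exposed p" and a: "adj u a"
  shows "maximum_matching (p(u := a, a := u, p a := p a))"
    and "exposed (p(u := a, a := u, p a := p a)) = insert (p a) (exposed p - {u})"
proof -
  define q where "q = p(u := a, a := u, p a := p a)"
  have m: "matching p"
    using p by (simp add: maximum_matching_def)
  have av: "a \<in> pverts G" "a \<noteq> u"
    using adj_verts[OF a] adj_neq[OF a] by auto
  have pa: "p a \<noteq> a"
    using exposed_not_adj[OF p u, of a] a av by (auto simp: exposed_def)
  have pv: "p a \<in> pverts G" "p (p a) = a"
    using m av adj_verts unfolding matching_def by auto
  have pu: "p a \<noteq> u"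
    using u pv av by (auto simp: exposed_def)
  have "p x \<noteq> u" "p x \<noteq> a" "p x \<noteq> p a" if "x \<in> pverts G" "x \<noteq> u" "x \<noteq> a" "x \<noteq> p a" for x
    using m u that av pv unfolding matching_def exposed_def by (auto, metis+)
  then have "matching q"
    using m u a adj_sym[OF a] av pa pu pv unfolding matching_def q_def exposed_def by auto
  moreover show ex: "exposed (p(u := a, a := u, p a := p a)) = insert (p a) (exposed p - {u})"
    using u av pa pu pv by (auto simp: exposed_def)
  have "card (exposed q) = card (exposed p)"
  proof -
    have "p a \<notin> exposed p"
      using pa pv by (simp add: exposed_def)
    then show ?thesis
      unfolding q_def ex using u finite_exposed
      by (metis card_Suc_Diff1 card_insert_disjoint finite_Diff DiffE)
  qed
  ultimately show "maximum_matching (p(u := a, a := u, p a := p a))"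
    using p unfolding maximum_matching_def q_def by metis
qed

end

section \<open>Companions and critical vertices, with the transversal \<open>R\<close> as
  tie-breaker\<close>

locale matched_twin_free_graph = pair_graph G for G :: "'a pair_pre_digraph" +
  fixes p :: "'a \<Rightarrow> 'a" and R :: "'a set"
  assumes maximum: "maximum_matching p"
    and transversal: "\<And>x. x \<in> pverts G \<Longrightarrow> p x \<noteq> x \<Longrightarrow> p x \<in> R \<longleftrightarrow> x \<notin> R"
    and twin_free: "twin_free G"
    and no_isolated: "\<nexists>u. isolated G u"
begin

lemma p_p: "x \<in> pverts G \<Longrightarrow> p (p x) = x"
  using maximum by (simp add: maximum_matching_def matching_def)

lemma adj_p: "x \<in> pverts G \<Longrightarrow> p x \<noteq> x \<Longrightarrow> adj x (p x)"
  using maximum by (auto simp: maximum_matching_def matching_def)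

lemma p_verts: "x \<in> pverts G \<Longrightarrow> p x \<in> pverts G"
  using adj_p adj_verts by metis

lemma not_twins:
  assumes "u \<in> pverts G" "v \<in> pverts G" "u \<noteq> v"
  shows "nbhd G u \<noteq> nbhd G v" and "closed_nbhd G u \<noteq> closed_nbhd G v"
  using twin_free assms by (auto simp: twin_free_def twins_def)

text \<open>The trace of such a u on \<open>S\<close> may be just \<open>{p b}\<close>, the set
  meant for b. An exchange through \<open>p b\<close> exposes b in place of u, so b can be treated
  like an exposed vertex.\<close>

definition companion :: "'a \<Rightarrow> 'a \<Rightarrow> bool" where
  "companion u b \<longleftrightarrow> b \<in> pverts G \<and> u \<in> exposed p \<and> adj u (p b) \<and> nbhd G u \<subseteq> {b, p b}"

text \<open>If \<open>u\<close>, \<open>b\<close> and \<open>p b\<close> form a triangle, then \<open>b\<close> and \<open>p b\<close> both have the companion \<open>u\<close>, and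
  \<open>R\<close> decides which of the two is critical.\<close>

definition critical :: "'a set" where
  "critical = {b. \<exists>u. companion u b \<and> (adj u b \<longrightarrow> b \<notin> R)}"

text \<open>These vertices will be assigned their whole trace on \<open>S\<close> instead of
  \<open>{p v}\<close>.\<close>

definition W :: "'a set" where
  "W = exposed p \<union> critical"

lemma companion_matched:
  assumes "companion u b"
  shows "b \<in> pverts G" "p b \<in> pverts G" "p (p b) = b" "p b \<noteq> b" "u \<in> exposed p" "p u = u"
    "u \<in> pverts G" "u \<noteq> b" "u \<noteq> p b" "adj u (p b)"
proof -
  show b: "b \<in> pverts G" and u: "u \<in> exposed p" and a: "adj u (p b)"
    using assms by (auto simp: companion_def)
  show "p b \<in> pverts G" "p (p b) = b"
    using b p_p p_verts by auto
  show "p u = u" "u \<in> pverts G"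
    using u by (auto simp: exposed_def)
  show "u \<noteq> p b"
    using a adj_neq by blast
  show "p b \<noteq> b"
    using exposed_not_adj[OF maximum u, of b] a b by (auto simp: exposed_def)
  then show "u \<noteq> b"
    using \<open>p u = u\<close> by auto
qed

text \<open>Otherwise w, c, \<open>p c\<close>, w' is an augmenting path.\<close>

lemma matching_edge_one_exposed:
  assumes w: "w \<in> exposed p" "w' \<in> exposed p" and "adj w c" "adj w' (p c)"
  shows "w = w'"
proof (rule ccontr)
  assume "w \<noteq> w'"
  then show False
    using exposed_not_adj[OF exchange(1)[OF maximum w(1) assms(3)], of w' "p c"]
      exchange(2)[OF maximum w(1) assms(3)] assms by simp
qed

lemma critical_cases:
  assumes "b \<in> critical"
  obtains u where "companion u b" "adj u b \<longrightarrow> b \<notin> R"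
  using assms by (auto simp: critical_def)

lemma critical_matched:
  assumes "b \<in> critical"
  shows "b \<in> pverts G" "p b \<in> pverts G" "p (p b) = b" "p b \<noteq> b" "b \<notin> exposed p"
  using assms companion_matched by (auto simp: critical_def exposed_def)

text \<open>Companions of b and of \<open>p b\<close> see opposite ends of one matching edge, so
  they coincide and span a triangle with it. There \<open>R\<close> admits only one of the two
  ends.\<close>

lemma partner_not_critical:
  assumes b: "b \<in> critical"
  shows "p b \<notin> critical"
proof
  assume "p b \<in> critical"
  then obtain u' where u': "companion u' (p b)" "adj u' (p b) \<longrightarrow> p b \<notin> R"
    by (rule critical_cases)
  obtain u where u: "companion u b" "adj u b \<longrightarrow> b \<notin> R"
    using b by (rule critical_cases)
  have "adj u (p b)" "adj u' b"
    using companion_matched[OF u(1)] companion_matched[OF u'(1)] by auto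
  moreover from this have "u' = u"
    using matching_edge_one_exposed[of u' u b] companion_matched[OF u(1)] companion_matched[OF u'(1)]
    by simp
  ultimately show False
    using u u' transversal[of b] critical_matched[OF b] by auto
qed

text \<open>The neighbours of u lie on one matching edge, which has at most one critical end. Hence
  exchanges for different critical vertices use different companions.\<close>

lemma companion_eq:
  assumes "companion u b" "companion u b'" "b \<in> critical" "b' \<in> critical"
  shows "b = b'"
proof -
  have "p b' = b \<or> p b' = p b"
    using assms(1,2) by (auto simp: companion_def nbhd_def)
  then show ?thesis
    using partner_not_critical critical_matched assms(3,4) by metis
qed

text \<open>A critical vertex becomes exposed by an exchange with a companion, and two such
  exchanges do not interfere. The exchange covers the companion, hence the excluded pairs. The
  clause on c keeps matching edges without a critical end available for augmenting paths.\<close>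

lemma W_exposable:
  assumes w: "w \<in> W" "w' \<in> W" "w \<noteq> w'" and nc: "\<not> companion w w'" "\<not> companion w' w"
  shows "\<exists>q. maximum_matching q \<and> w \<in> exposed q \<and> w' \<in> exposed q \<and>
    (\<forall>c\<in>pverts G. p c \<noteq> c \<longrightarrow> c \<notin> critical \<longrightarrow> p c \<notin> critical \<longrightarrow> q c = p c)"
proof -
  let ?P = "\<lambda>w w'. \<exists>q. maximum_matching q \<and> w \<in> exposed q \<and> w' \<in> exposed q \<and>
    (\<forall>c\<in>pverts G. p c \<noteq> c \<longrightarrow> c \<notin> critical \<longrightarrow> p c \<notin> critical \<longrightarrow> q c = p c)"
  have UK: "?P w w'" if w: "w \<in> exposed p" "w' \<in> critical" and nc: "\<not> companion w w'" for w w'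
  proof -
    obtain u where u: "companion u w'"
      using w(2) by (rule critical_cases)
    note cm = companion_matched[OF u]
    have "u \<noteq> w"
      using nc u by blast
    then show ?thesis
      using exchange[OF maximum cm(5,10)] cm w
      by (intro exI[of _ "p(u := p w', p w' := u, p (p w') := p (p w'))"]) auto
  qed
  have KK: "?P w w'" if w: "w \<in> critical" "w' \<in> critical" "w \<noteq> w'" for w w'
  proof -
    obtain u where u: "companion u w"
      using w(1) by (rule critical_cases)
    obtain u' where u': "companion u' w'"
      using w(2) by (rule critical_cases)
    note cm = companion_matched[OF u] and cm' = companion_matched[OF u']
    have uu: "u \<noteq> u'"
      using companion_eq u u' w by blast
    define q where "q = p(u := p w, p w := u, p (p w) := p (p w))"
    have q: "maximum_matching q" "exposed q = insert w (exposed p - {u})"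
      using exchange[OF maximum cm(5,10)] cm(3) by (auto simp: q_def)
    have ne: "p w' \<noteq> u" "p w' \<noteq> p w" "p w' \<noteq> w"
      using cm cm' w partner_not_critical by metis+
    then have qw: "q (p w') = w'"
      using cm cm' by (auto simp: q_def)
    have u'q: "u' \<in> exposed q"
      using q uu cm' by auto
    \<comment> \<open>The second exchange is made in \<open>q\<close>, which still matches
      \<open>p w'\<close> with w'; w stays exposed.\<close>
    define r where "r = q(u' := p w', p w' := u', q (p w') := q (p w'))"
    have r: "maximum_matching r" "exposed r = insert w' (exposed q - {u'})"
      using exchange[OF q(1) u'q cm'(10)] qw by (auto simp: r_def)
    have "w \<noteq> u'"
      using cm cm' by metis
    then have "w \<in> exposed r" "w' \<in> exposed r"
      using r q by auto
    moreover have "r c = p c" if "p c \<noteq> c" "c \<notin> critical" "p c \<notin> critical" for c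
    proof -
      have "c \<notin> {u, w, p w, u', w', p w'}"
        using that w cm cm' by auto
      then show ?thesis
        by (simp add: r_def qw) (simp add: q_def cm)
    qed
    ultimately show ?thesis
      using r(1) by blast
  qed
  consider "w \<in> exposed p" "w' \<in> exposed p" | "w \<in> exposed p" "w' \<in> critical"
    | "w \<in> critical" "w' \<in> exposed p" | "w \<in> critical" "w' \<in> critical"
    using w by (auto simp: W_def)
  then show ?thesis
  proof cases
    case 1
    then show ?thesis
      using maximum by blast
  next
    case 2
    then show ?thesis
      using UK nc by blast
  next
    case 3
    then show ?thesis
      using UK[of w' w] nc by blast
  next
    case 4
    then show ?thesis
      using KK w by blast
  qed
qed

lemma W_adj_companion:
  assumes "w \<in> W" "w' \<in> W" "adj w w'"
  shows "companion w w' \<or> companion w' w"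
  using W_exposable[OF assms(1,2) adj_neq[OF assms(3)]] exposed_not_adj assms(3) by metis

text \<open>The path w, c, \<open>p c\<close>, w' is augmenting for a maximum matching that exposes
  both w and w' and retains the edge at c.\<close>

lemma matching_edge_one_W:
  assumes w: "w \<in> W" "w' \<in> W" and adj: "adj w c" "adj w' (p c)"
    and c: "p c \<noteq> c" "c \<notin> critical" "p c \<notin> critical"
  shows "w = w'"
proof (rule ccontr)
  assume ne: "w \<noteq> w'"
  have cv: "c \<in> pverts G"
    using adj adj_verts by blast
  have nc: "\<not> companion w w'" "\<not> companion w' w"
  proof -
    \<comment> \<open>A companion of y sees only the matching edge of the critical y, but the edge
      at c has no critical end.\<close>
    have *: False if comp: "companion x y" and "y \<in> W" and "adj x c \<or> adj x (p c)" for x y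
    proof -
      have "y \<in> critical"
        using that companion_matched(4)[OF comp] by (auto simp: W_def exposed_def)
      moreover have "c \<in> {y, p y} \<or> p c \<in> {y, p y}"
        using that by (auto simp: companion_def nbhd_def)
      ultimately show False
        using c p_p[OF cv] critical_matched(3)[OF \<open>y \<in> critical\<close>] by (metis insert_iff empty_iff)
    qed
    show "\<not> companion w w'" "\<not> companion w' w"
      using * w adj by blast+
  qed
  obtain q where q: "maximum_matching q" "w \<in> exposed q" "w' \<in> exposed q" "q c = p c"
    using W_exposable[OF w ne nc] c cv by blast
  show False
    using exposed_not_adj[OF exchange(1)[OF q(1,2) adj(1)], of w' "q c"]
      exchange(2)[OF q(1,2) adj(1)] ne q adj by simp
qed

text \<open>In a triangle u, b, \<open>p b\<close> the exchange through b exposes \<open>p b\<close>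
  in place of u. As w is exposed too, possibly after a second exchange, it cannot see
  \<open>p b\<close>.\<close>

lemma triangle_isolated_from_W:
  assumes u: "companion u b" "b \<in> critical" "adj u b"
    and w: "w \<in> W" "w \<noteq> u" "w \<noteq> b"
  shows "\<not> adj w (p b)"
proof
  assume adj: "adj w (p b)"
  note cm = companion_matched[OF u(1)]
  define q where "q = p(u := b, b := u, p b := p b)"
  have q: "maximum_matching q" "exposed q = insert (p b) (exposed p - {u})"
    using exchange[OF maximum cm(5) u(3)] by (auto simp: q_def)
  show False
  proof (cases "w \<in> exposed p")
    case True
    then show False
      using exposed_not_adj[OF q(1), of w "p b"] q w adj by simp
  next
    case False
    then have wc: "w \<in> critical"
      using w by (simp add: W_def)
    then obtain u' where u': "companion u' w"
      by (rule critical_cases)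
    note cm' = companion_matched[OF u']
    have uu: "u' \<noteq> u"
      using companion_eq u u' w wc by blast
    have ne: "p w \<noteq> u" "p w \<noteq> b" "p w \<noteq> p b"
      using cm cm' w wc u(2) partner_not_critical by metis+
    then have qw: "q (p w) = w"
      using cm' by (simp add: q_def)
    have u'q: "u' \<in> exposed q"
      using q uu cm' by auto
    have "u' \<noteq> p b"
      using cm cm' by metis
    then show False
      using exposed_not_adj[OF exchange(1)[OF q(1) u'q cm'(10)], of w "p b"]
        exchange(2)[OF q(1) u'q cm'(10)] qw q adj by simp
  qed
qed

section \<open>The set \<open>S\<close> and what \<open>W\<close> sees of it\<close>

definition sees_W :: "'a \<Rightarrow> bool" where
  "sees_W x \<longleftrightarrow> (\<exists>w\<in>W. adj w x)"

text \<open>One end of each matching edge, by priority: critical ends stay out, ends seen from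
  \<open>W\<close> are preferred so that \<open>W\<close> has traces on \<open>S\<close>, and
  \<open>R\<close> breaks ties.\<close>

definition S :: "'a set" where
  "S = {x \<in> pverts G. p x \<noteq> x \<and> x \<notin> critical \<and>
    (p x \<in> critical \<or> (sees_W x \<and> \<not> sees_W (p x)) \<or> ((sees_W x \<longleftrightarrow> sees_W (p x)) \<and> x \<in> R))}"

lemma partner_in_S_iff:
  assumes "x \<in> pverts G" "p x \<noteq> x"
  shows "p x \<in> S \<longleftrightarrow> x \<notin> S"
  using assms p_p[of x] p_verts[of x] transversal[of x] partner_not_critical
  by (auto simp: S_def)

lemma card_S: "2 * card S \<le> card (pverts G)"
proof -
  have "p ` S \<inter> S = {}"
    using partner_in_S_iff by (auto simp: S_def)
  moreover have "inj_on p S"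
    by (rule inj_on_inverseI[where g = p]) (simp add: S_def p_p)
  moreover have fin: "finite S"
    by (simp add: S_def)
  ultimately have "card (S \<union> p ` S) = 2 * card S"
    using card_Un_disjoint[of S "p ` S"] card_image[of p S] by (simp add: Int_commute)
  moreover have "S \<union> p ` S \<subseteq> pverts G"
    using p_verts by (auto simp: S_def)
  ultimately show ?thesis
    using card_mono[of "pverts G" "S \<union> p ` S"] by simp
qed

lemma W_S_disjoint: "w \<in> W \<Longrightarrow> w \<notin> S"
  by (auto simp: W_def S_def exposed_def)

lemma W_verts: "w \<in> W \<Longrightarrow> w \<in> pverts G"
  using critical_matched by (auto simp: W_def exposed_def)

text \<open>As x is seen but was not chosen, \<open>p x\<close> must be seen too, and
  \<open>matching_edge_one_W\<close> forces w itself to see it.\<close>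

lemma partner_seen:
  assumes w: "w \<in> W" "adj w x" and x: "x \<notin> S" "x \<notin> W"
  shows "p x \<in> S" "adj w (p x)" "p x \<noteq> x" "x \<notin> critical" "p x \<notin> critical"
proof -
  have xv: "x \<in> pverts G"
    using w adj_verts by blast
  show px: "p x \<noteq> x" and xc: "x \<notin> critical"
    using x xv by (auto simp: W_def exposed_def)
  show pS: "p x \<in> S"
    using partner_in_S_iff[OF xv px] x by blast
  then show pc: "p x \<notin> critical"
    by (simp add: S_def)
  have "sees_W x"
    using w by (auto simp: sees_W_def)
  then have "sees_W (p x)"
    using pS xc p_p[OF xv] by (auto simp: S_def)
  then obtain w' where "w' \<in> W" "adj w' (p x)"
    by (auto simp: sees_W_def)
  moreover from this have "w = w'"
    using matching_edge_one_W[OF w(1) _ w(2) _ px xc pc] by blast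
  ultimately show "adj w (p x)"
    by simp
qed

text \<open>The matched vertex b cannot be a companion, so u is one, and u, b, \<open>p b\<close>
  form a triangle.\<close>

lemma exposed_adj_critical:
  assumes "u \<in> exposed p" "b \<in> critical" "adj u b"
  shows "companion u b" "nbhd G u = {b, p b}" "p b \<in> S"
proof -
  have "\<not> companion b u"
    using assms critical_matched companion_matched(5) by blast
  then show c: "companion u b"
    using W_adj_companion[of u b] assms by (auto simp: W_def)
  then show "nbhd G u = {b, p b}"
    using assms(3) by (auto simp: companion_def nbhd_def)
  show "p b \<in> S"
    using critical_matched[OF assms(2)] partner_in_S_iff W_S_disjoint assms(2)
    by (metis UnCI W_def)
qed

lemma W_adjE:
  assumes "w \<in> W" "w' \<in> W" "adj w w'"
  obtains "w \<in> exposed p" "w' \<in> critical" | "w' \<in> exposed p" "w \<in> critical"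
proof -
  consider "companion w w'" | "companion w' w"
    using W_adj_companion assms by blast
  then show thesis
    by cases (use assms that companion_matched in \<open>auto simp: W_def exposed_def\<close>)
qed

section \<open>Domination and location\<close>

lemma W_dominated:
  assumes w: "w \<in> W"
  shows "nbhd G w \<inter> S \<noteq> {}"
proof (cases "w \<in> critical")
  case True
  then have "adj w (p w)" "p w \<in> S"
    using critical_matched[OF True] adj_p partner_in_S_iff W_S_disjoint[OF w] by auto
  then show ?thesis
    by (auto simp: nbhd_def)
next
  case False
  then have we: "w \<in> exposed p"
    using w by (simp add: W_def)
  obtain x where x: "adj w x"
    using no_isolated W_verts[OF w] by (auto simp: isolated_def nbhd_def)
  consider "x \<in> S" | "x \<in> W" | "x \<notin> S" "x \<notin> W"
    by blast
  then show ?thesis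
  proof cases
    case 1
    then show ?thesis
      using x by (auto simp: nbhd_def)
  next
    case 2
    then have "x \<in> critical"
      using W_adjE[OF w _ x] False by blast
    then show ?thesis
      using exposed_adj_critical[OF we _ x] by auto
  next
    case 3
    then show ?thesis
      using partner_seen[OF w x] by (auto simp: nbhd_def)
  qed
qed

text \<open>Equal traces exclude neighbours outside \<open>S\<close> and \<open>W\<close>
  (\<open>sub\<close>) and inside \<open>W\<close> (\<open>tri\<close>). Both neighbourhoods then
  lie in \<open>S\<close>, so w and w' would be open twins.\<close>

lemma W_located:
  assumes w: "w \<in> W" "w' \<in> W" and eq: "nbhd G w \<inter> S = nbhd G w' \<inter> S"
  shows "w = w'"
proof (rule ccontr)
  assume ne: "w \<noteq> w'"
  have sub: "x \<in> S \<union> W"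
    if w: "w \<in> W" "w' \<in> W" "w \<noteq> w'" and eq: "nbhd G w \<inter> S = nbhd G w' \<inter> S"
      and x: "adj w x" for w w' x
  proof (rule ccontr)
    assume "x \<notin> S \<union> W"
    note ps = partner_seen[OF w(1) x]
    have "adj w' (p x)"
      using ps eq \<open>x \<notin> S \<union> W\<close> by (auto simp: nbhd_def)
    then show False
      using matching_edge_one_W[OF w(1,2) x] ps w(3) \<open>x \<notin> S \<union> W\<close> by blast
  qed
  \<comment> \<open>The edge wx belongs to a triangle u, b, \<open>p b\<close> with
    \<open>p b\<close> in \<open>S\<close>. Equal traces make w' see \<open>p b\<close>, so w' is x,
    and u and b turn out to be closed twins.\<close>
  have tri: False
    if w: "w \<in> W" "w' \<in> W" "w \<noteq> w'" and eq: "nbhd G w \<inter> S = nbhd G w' \<inter> S"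
      and x: "x \<in> W" "adj w x" for w w' x
  proof -
    obtain u b where ub: "u \<in> exposed p" "b \<in> critical" "adj u b" "{w, x} = {u, b}"
    proof (rule W_adjE[OF w(1) x])
      assume "w \<in> exposed p" "x \<in> critical"
      then show thesis
        using that[of w x] x by blast
    next
      assume "x \<in> exposed p" "w \<in> critical"
      then show thesis
        using that[of x w] adj_sym[OF x(2)] by blast
    qed
    note tr = exposed_adj_critical[OF ub(1-3)]
    note cm = critical_matched[OF ub(2)]
    have "adj u (p b)" "adj b (p b)"
      using tr(2) adj_p cm by (auto simp: nbhd_def)
    then have "p b \<in> nbhd G w'"
      using eq tr(3) ub(4) by (auto simp: nbhd_def doubleton_eq_iff)
    then have "w' \<in> {u, b}"
      using triangle_isolated_from_W[OF tr(1) ub(2,3) w(2)] by (auto simp: nbhd_def)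
    then have eq': "nbhd G u \<inter> S = nbhd G b \<inter> S"
      using w(3) eq ub(4) by (auto simp: doubleton_eq_iff)
    have W: "u \<in> W" "b \<in> W" "u \<noteq> b"
      using ub adj_neq by (auto simp: W_def)
    have "nbhd G b \<subseteq> {u, p b}"
    proof
      fix y
      assume "y \<in> nbhd G b"
      then have y: "adj b y"
        by (simp add: nbhd_def)
      then have "y \<in> S \<or> y \<in> W"
        using sub[OF W(2,1) _ eq'[symmetric] y] W by blast
      then show "y \<in> {u, p b}"
      proof
        assume "y \<in> S"
        then have "y \<in> nbhd G u"
          using eq' y by (auto simp: nbhd_def)
        then show ?thesis
          using tr(2) adj_neq[OF y] by simp
      next
        assume yW: "y \<in> W"
        then have "y \<in> exposed p"
          using W_adjE[OF W(2) yW y] cm by blast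
        \<comment> \<open>Both y and u are exposed and see opposite ends of the edge at b, so y =
          u.\<close>
        then show ?thesis
          using matching_edge_one_exposed[of y u b] ub(1) y adj_sym \<open>adj u (p b)\<close> by blast
      qed
    qed
    then have "closed_nbhd G u = closed_nbhd G b"
      using tr(2) adj_sym[OF ub(3)] \<open>adj b (p b)\<close> by (auto simp: closed_nbhd_def nbhd_def)
    then show False
      using not_twins(2) W W_verts by blast
  qed
  have "nbhd G w \<subseteq> S" "nbhd G w' \<subseteq> S"
    using sub[OF w ne eq] tri[OF w ne eq] sub[OF w(2,1) ne[symmetric] eq[symmetric]]
      tri[OF w(2,1) ne[symmetric] eq[symmetric]] by (auto simp: nbhd_def)
  then have "nbhd G w = nbhd G w'"
    using eq by blast
  then show False
    using not_twins(1) w W_verts ne by blast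
qed

text \<open>This is the conflict that critical vertices resolve: an exposed w with trace
  \<open>{p b}\<close> has all neighbours in \<open>{b, p b}\<close>, which makes b or
  \<open>p b\<close> critical, while b is outside \<open>W\<close> and \<open>p b\<close> is in
  \<open>S\<close>.\<close>

lemma W_located_from_rest:
  assumes w: "w \<in> W" and b: "b \<in> pverts G" "b \<notin> S" "b \<notin> W"
  shows "nbhd G w \<inter> S \<noteq> {p b}"
proof
  assume eq: "nbhd G w \<inter> S = {p b}"
  have pb: "p b \<noteq> b" "p (p b) = b" "p b \<in> S"
    using b p_p partner_in_S_iff by (auto simp: W_def exposed_def)
  show False
  proof (cases "w \<in> critical")
    case True
    then have "p w \<in> nbhd G w \<inter> S"
      using critical_matched[OF True] adj_p partner_in_S_iff W_S_disjoint[OF w]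
      by (auto simp: nbhd_def)
    then have "p w = p b"
      using eq by blast
    then show False
      using critical_matched(3)[OF True] pb(2) w b(3) by metis
  next
    case False
    then have we: "w \<in> exposed p"
      using w by (simp add: W_def)
    have "nbhd G w \<subseteq> {b, p b}"
    proof
      fix x
      assume "x \<in> nbhd G w"
      then have x: "adj w x"
        by (simp add: nbhd_def)
      consider "x \<in> S" | "x \<in> W" | "x \<notin> S" "x \<notin> W"
        by blast
      then show "x \<in> {b, p b}"
      proof cases
        case 1
        then show ?thesis
          using eq x by (auto simp: nbhd_def)
      next
        case 2
        then have "x \<in> critical"
          using W_adjE[OF w _ x] False by blast
        then have "p x \<in> nbhd G w \<inter> S"
          using exposed_adj_critical[OF we _ x] by blast
        then have "p x = p b"
          using eq by blast
        then show ?thesis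
          using pb(2) critical_matched(3)[OF \<open>x \<in> critical\<close>] by (metis insertI1)
      next
        case 3
        then have "p x \<in> nbhd G w \<inter> S"
          using partner_seen[OF w x] by (simp add: nbhd_def)
        then have "p x = p b"
          using eq by blast
        then show ?thesis
          using pb(2) p_p adj_verts[OF x] by (metis insertI1)
      qed
    qed
    moreover have "adj w (p b)"
      using eq by (auto simp: nbhd_def)
    ultimately have c: "companion w b"
      using b we by (simp add: companion_def)
    \<comment> \<open>As b is not critical, this is the triangle case that \<open>R\<close> decides
      in favour of \<open>p b\<close>.\<close>
    then have "adj w b" "b \<in> R"
      using b by (auto simp: W_def critical_def)
    then have "companion w (p b)" "p b \<notin> R"
      using c pb b transversal p_verts by (auto simp: companion_def)
    then have "p b \<in> critical"
      by (auto simp: critical_def)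
    then show False
      using pb by (simp add: S_def)
  qed
qed

section \<open>The bound by half the order\<close>

lemma lower_gamma_LD_le_half: "2 * lower_gamma_LD G \<le> card (pverts G)"
proof -
  define f where "f v = (if v \<in> W then nbhd G v \<inter> S else {p v})" for v
  have rest: "adj v (p v)" "p v \<in> S" if "v \<in> pverts G - S" "v \<notin> W" for v
    using that adj_p partner_in_S_iff by (auto simp: W_def exposed_def)
  have "f v \<noteq> {} \<and> f v \<subseteq> nbhd G v \<inter> S" if "v \<in> pverts G - S" for v
    using W_dominated rest[OF that] by (auto simp: f_def nbhd_def)
  moreover have "inj_on f (pverts G - S)"
  proof (rule inj_onI)
    fix v v'
    assume v: "v \<in> pverts G - S" "v' \<in> pverts G - S" and eq: "f v = f v'"
    show "v = v'"
    proof (cases "v \<in> W"; cases "v' \<in> W")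
      assume "v \<in> W" "v' \<in> W"
      then show ?thesis
        using eq W_located by (simp add: f_def)
    next
      assume "v \<in> W" "v' \<notin> W"
      then show ?thesis
        using eq v W_located_from_rest[of v v'] by (simp add: f_def)
    next
      assume "v \<notin> W" "v' \<in> W"
      then show ?thesis
        using eq v W_located_from_rest[of v' v] by (simp add: f_def)
    next
      assume "v \<notin> W" "v' \<notin> W"
      then show ?thesis
        using eq v p_p by (metis DiffD1 f_def singleton_inject)
    qed
  qed
  moreover have "S \<subseteq> pverts G"
    by (auto simp: S_def)
  ultimately have "lower_gamma_LD G \<le> card S"
    using lower_gamma_LD_le[of G S f] pair_graph_axioms by blast
  then show ?thesis
    using card_S by simp
qed

end

theorem theorem1:
  fixes G :: "'a pair_pre_digraph" and n :: nat
  assumes "pair_graph G"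
    and "card (pverts G) = n"
    and "twin_free G"
    and "\<not> (\<exists>u. isolated G u)"
  shows "real (lower_gamma_LD G) \<le> real n / 2"
proof -
  interpret pair_graph G by fact
  obtain p where p: "maximum_matching p"
    using maximum_matching_exists by blast
  obtain g :: "'a \<Rightarrow> nat" where g: "inj_on g (pverts G)"
    using finite_imp_inj_to_nat_seg[OF pair_finite_verts] by blast
  \<comment> \<open>The transversal takes the end with the smaller number from each matching
    edge.\<close>
  have "p x \<in> {x. g x < g (p x)} \<longleftrightarrow> x \<notin> {x. g x < g (p x)}"
    if x: "x \<in> pverts G" "p x \<noteq> x" for x
  proof -
    have "p (p x) = x" "p x \<in> pverts G"
      using p x adj_verts by (auto simp: maximum_matching_def matching_def)
    then show ?thesis
      using inj_onD[OF g, of "p x" x] x by fastforce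
  qed
  then interpret matched_twin_free_graph G p "{x. g x < g (p x)}"
    using p assms by unfold_locales auto
  show ?thesis
    using lower_gamma_LD_le_half assms(2) by simp
qed

end
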